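(* Let $(S_O,P_O)$ be a deductive source with nonempty core $A=\mathrm{Atom}(S_O)$, and let $V\subseteq\mathbb{S}_O$ be a restricted reconstruction alphabet. For each $a\in A$ define $R_{\mathrm{Cn}}^{(V)}(a)=\{\hat s\in V: d_{\mathrm{Cn}}(a,\hat s\mid S_O)=0\}$. Assume that (H1) $R_{\mathrm{Cn}}^{(V)}(a)\neq\varnothing$ for every $a\in A$; (H2) $R_{\mathrm{Cn}}^{(V)}(a_1)\cap R_{\mathrm{Cn}}^{(V)}(a_2)=\varnothing$ for distinct $a_1,a_2\in A$. Then $$R_{\mathrm{sem}}^{(V)}(0;d_{\mathrm{Cn}},P_O)=P_A\,H(\pi_A),$$ with the convention that the right-hand side is $0$ when $P_A=0$. Conversely (without assuming (H1), (H2)), if there exists $a\in A$ with $P_O(a)>0$ and $R_{\mathrm{Cn}}^{(V)}(a)=\varnothing$, then the zero-distortion feasible set is empty, i.e. $R_{\mathrm{sem}}^{(V)}(0;d_{\mathrm{Cn}},P_O)=\infty$.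
   Context: Setting. $\mathbb{S}_O$ is a finite set of statements with a fixed proof system with decidable derivability; $\mathrm{Cn}(\Gamma)\subseteq\mathbb{S}_O$ denotes the set of statements derivable from $\Gamma\subseteq\mathbb{S}_O$. $\mathrm{Cn}$ is reflexive ($\Gamma\subseteq\mathrm{Cn}(\Gamma)$), monotone ($\Gamma\subseteq\Gamma'\Rightarrow\mathrm{Cn}(\Gamma)\subseteq\mathrm{Cn}(\Gamma')$) and idempotent. $S_O\subseteq\mathbb{S}_O$ is a finite knowledge base with a fixed linear (canonical) order, and a deductive source is a pair $(S_O,P_O)$ with $P_O$ a probability distribution on $S_O$. Core. $\mathrm{Atom}(S_O)$ is the output of the deletion procedure: start with $B=S_O$; scan the elements $s$ of $S_O$ in the canonical order; whenever the scanned $s$ satisfies $s\in\mathrm{Cn}(B\setminus\{s\})$ for the current $B$, remove $s$ from $B$; the final $B$ is $\mathrm{Atom}(S_O)$. Put $A=\mathrm{Atom}(S_O)$, $P_A=P_O(A)$ and, if $P_A>0$, $\pi_A(a)=P_O(a)/P_A$ for $a\in A$. Closure distortion. For $s\in S_O$, $\hat s\in\mathbb{S}_O$, let $C_s=\mathrm{Cn}(S_O)$ and $C_{\hat s}=\mathrm{Cn}((S_O\setminus\{s\})\cup\{\hat s\})$; then $d_{\mathrm{Cn}}(s,\hat s)=d_{\mathrm{Cn}}(s,\hat s\mid S_O)=1-|C_s\cap C_{\hat s}|/|C_s\cup C_{\hat s}|$, with $0/0$ giving distortion $0$. Restricted-alphabet rate–distortion function. $R_{\mathrm{sem}}^{(V)}(D;d_{\mathrm{Cn}},P_O)$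 is the minimum of the mutual information $I(\mathsf S_o;\hat{\mathsf S}_o)$ over test channels $P_{\hat S\mid S}$ with $\mathsf S_o\sim P_O$, $\hat{\mathsf S}_o\in V$ almost surely, and $\mathbb{E}[d_{\mathrm{Cn}}(\mathsf S_o,\hat{\mathsf S}_o)]\le D$ ($\infty$ if there is none). $H$ is Shannon entropy. *)

theory Defs
  imports "HOL-Probability.Probability" "HOL-Library.Extended_Real"
begin

text \<open>
  The finite universe of statements is the finite type \<open>'s\<close>. The proof system enters
  only through its consequence operator \<open>Cn\<close>; derivability over a finite universe is
  automatically decidable, so decidability is not a separate hypothesis.
\<close>

locale consequence_operator =
  fixes Cn :: "'s::finite set \<Rightarrow> 's set"
  assumes Cn_reflexive: "\<Gamma> \<subseteq> Cn \<Gamma>"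
    and Cn_monotone: "\<Gamma> \<subseteq> \<Gamma>' \<Longrightarrow> Cn \<Gamma> \<subseteq> Cn \<Gamma>'"
    and Cn_idempotent: "Cn (Cn \<Gamma>) = Cn \<Gamma>"

text \<open>
  A knowledge base together with its canonical linear order is a duplicate-free list \<open>KB\<close>;
  the underlying set is \<open>set KB\<close>. The source distribution need not have full support.
\<close>

locale deductive_source = consequence_operator Cn
  for Cn :: "'s::finite set \<Rightarrow> 's set" +
  fixes KB :: "'s list" and P :: "'s pmf"
  assumes KB_distinct: "distinct KB"
    and P_support: "set_pmf P \<subseteq> set KB"

definition Atom :: "('s set \<Rightarrow> 's set) \<Rightarrow> 's list \<Rightarrow> 's set" where
  "Atom Cn KB = fold (\<lambda>s B. if s \<in> Cn (B - {s}) then B - {s} else B) KB (set KB)"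

text \<open>The case distinction is needed because \<open>0 / 0 = 0\<close> in HOL would give distortion 1.\<close>

definition closure_distortion :: "('s set \<Rightarrow> 's set) \<Rightarrow> 's set \<Rightarrow> 's \<Rightarrow> 's \<Rightarrow> real" where
  "closure_distortion Cn S s t =
    (let C = Cn S; C' = Cn ((S - {s}) \<union> {t})
     in if C \<union> C' = {} then 0 else 1 - real (card (C \<inter> C')) / real (card (C \<union> C')))"

definition zero_distortion_set ::
    "('s set \<Rightarrow> 's set) \<Rightarrow> 's set \<Rightarrow> 's set \<Rightarrow> 's \<Rightarrow> 's set" where
  "zero_distortion_set Cn S V a = {t \<in> V. closure_distortion Cn S a t = 0}"

text \<open>
  A test channel is a Markov kernel \<open>W\<close>; only its values on the support of the source
  affect the joint law.
\<close>

definition joint_pmf :: "'s pmf \<Rightarrow> ('s \<Rightarrow> 't pmf) \<Rightarrow> ('s \<times> 't) pmf" where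
  "joint_pmf P W = bind_pmf P (\<lambda>s. map_pmf (Pair s) (W s))"

definition channel_information :: "real \<Rightarrow> 's::finite pmf \<Rightarrow> ('s \<Rightarrow> 's pmf) \<Rightarrow> real" where
  "channel_information b P W =
    prob_space.mutual_information (measure_pmf (joint_pmf P W)) b
      (count_space UNIV) (count_space UNIV) fst snd"

definition feasible_channels ::
    "'s set \<Rightarrow> ('s \<Rightarrow> 's \<Rightarrow> real) \<Rightarrow> 's pmf \<Rightarrow> real \<Rightarrow> ('s \<Rightarrow> 's pmf) set" where
  "feasible_channels V d P D =
    {W. (AE (s, t) in measure_pmf (joint_pmf P W). t \<in> V) \<and>
        measure_pmf.expectation (joint_pmf P W) (\<lambda>(s, t). d s t) \<le> D}"

text \<open>
  \<open>LEAST\<close> is the attained minimum, not merely the infimum. The parameter \<open>b\<close> is the base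
  of the logarithm.
\<close>

definition rate_distortion ::
    "real \<Rightarrow> 's::finite set \<Rightarrow> ('s \<Rightarrow> 's \<Rightarrow> real) \<Rightarrow> 's pmf \<Rightarrow> real \<Rightarrow> ereal" where
  "rate_distortion b V d P D =
    (if feasible_channels V d P D = {} then \<infinity>
     else ereal (LEAST r. r \<in> channel_information b P ` feasible_channels V d P D))"

definition pmf_entropy :: "real \<Rightarrow> 's pmf \<Rightarrow> real" where
  "pmf_entropy b p = prob_space.entropy (measure_pmf p) b (count_space UNIV) (\<lambda>x. x)"

end

theory Submission
  imports Defs
begin

text \<open>
  Statements outside the core \<open>A\<close> are redundant, so any reconstruction in \<open>V\<close> derivable from
  the knowledge base represents them without distortion. They can therefore be reconstructed
  at random with the output law produced by the core, at no cost in information, and only the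
  core contributes. Within the core, disjoint zero-distortion sets let the reconstruction
  determine the source symbol, which forces the rate \<open>P(A) H(P | A)\<close>.
\<close>

section \<open>Zeros of the closure distortion\<close>

lemma closure_distortion_nonneg: "0 \<le> closure_distortion Cn S s (t::'s::finite)"
proof -
  have "real (card (C \<inter> D)) / real (card (C \<union> D)) \<le> 1" for C D :: "'s set"
    using card_mono[of "C \<union> D" "C \<inter> D"] by (auto simp: divide_le_eq_1 card_gt_0_iff)
  then show ?thesis
    by (simp add: closure_distortion_def Let_def)
qed

text \<open>Finite sets whose intersection and union have equal size coincide; when the union is
  empty, the convention agrees because both closures are empty.\<close>

lemma closure_distortion_eq_0_iff:
  "closure_distortion Cn S s (t::'s::finite) = 0 \<longleftrightarrow> Cn (insert t (S - {s})) = Cn S"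
proof -
  have "1 - real (card (C \<inter> D)) / real (card (C \<union> D)) = 0 \<longleftrightarrow> C = D"
    if "C \<union> D \<noteq> {}" for C D :: "'s set"
  proof -
    have "card (C \<union> D) > 0"
      using that by (simp add: card_gt_0_iff)
    then have "1 - real (card (C \<inter> D)) / real (card (C \<union> D)) = 0
        \<longleftrightarrow> card (C \<inter> D) = card (C \<union> D)"
      by (auto simp: field_simps)
    also have "\<dots> \<longleftrightarrow> C \<inter> D = C \<union> D"
      using card_subset_eq[of "C \<union> D" "C \<inter> D"] by auto
    finally show ?thesis
      by auto
  qed
  from this[of "Cn S" "Cn (insert t (S - {s}))"] show ?thesis
    by (auto simp: closure_distortion_def Let_def)
qed

section \<open>The core and redundant statements\<close>

context consequence_operator
begin

lemma Cn_remove_derivable: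
  assumes "s \<in> Cn (B - {s})"
  shows "Cn (B - {s}) = Cn B"
proof
  have "B \<subseteq> Cn (B - {s})"
    using assms Cn_reflexive[of "B - {s}"] by blast
  then show "Cn B \<subseteq> Cn (B - {s})"
    using Cn_monotone Cn_idempotent by blast
qed (simp add: Cn_monotone)

lemma Atom_subset: "Atom Cn xs \<subseteq> set xs"
proof -
  have "fold (\<lambda>s B. if s \<in> Cn (B - {s}) then B - {s} else B) ys B \<subseteq> B" for ys B
  proof (induction ys arbitrary: B)
    case (Cons y ys)
    show ?case
      using Cons[of B] Cons[of "B - {y}"] by auto
  qed simp
  then show ?thesis
    by (simp add: Atom_def)
qed

text \<open>Each deletion drops a statement derivable from the rest, so the closure is invariant
  along the scan.\<close>

lemma Cn_Atom: "Cn (Atom Cn xs) = Cn (set xs)"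
proof -
  have "Cn (fold (\<lambda>s B. if s \<in> Cn (B - {s}) then B - {s} else B) ys B) = Cn B" for ys B
    by (induction ys arbitrary: B) (auto simp: Cn_remove_derivable)
  then show ?thesis
    by (simp add: Atom_def)
qed

lemma zero_distortion_imp_derivable:
  assumes "closure_distortion Cn S s t = 0"
  shows "t \<in> Cn S"
  using assms Cn_reflexive[of "insert t (S - {s})"]
  by (auto simp: closure_distortion_eq_0_iff)

text \<open>Removing \<open>s\<close> leaves the core in place, and the core already generates the
  whole closure; a derivable \<open>t\<close> adds nothing to it.\<close>

lemma zero_distortion_outside_Atom:
  assumes "s \<notin> Atom Cn xs" "t \<in> Cn (set xs)"
  shows "closure_distortion Cn (set xs) s t = 0"
proof -
  have "Cn (Atom Cn xs) \<subseteq> Cn (insert t (set xs - {s}))"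
    using assms(1) Atom_subset by (intro Cn_monotone) auto
  moreover have "insert t (set xs - {s}) \<subseteq> Cn (set xs)"
    using assms(2) Cn_reflexive[of "set xs"] by auto
  then have "Cn (insert t (set xs - {s})) \<subseteq> Cn (set xs)"
    using Cn_monotone Cn_idempotent by blast
  ultimately show ?thesis
    by (auto simp: closure_distortion_eq_0_iff Cn_Atom)
qed

end

section \<open>Joint laws and zero-distortion channels\<close>

lemma pmf_joint_pmf:
  "pmf (joint_pmf P W) (s, t) = pmf P s * pmf (W s) t"
proof -
  have "pmf (map_pmf (Pair x) (W x)) (s, t) = indicator {s} x * pmf (W s) t" for x
  proof (cases "x = s")
    case True
    then show ?thesis
      by (simp add: pmf_map_inj' inj_on_def)
  next
    case False
    then show ?thesis
      by (auto simp: pmf_eq_0_set_pmf)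
  qed
  then show ?thesis
    by (simp add: joint_pmf_def pmf_bind measure_pmf_single)
qed

lemma set_joint_pmf: "set_pmf (joint_pmf P W) = Sigma (set_pmf P) (\<lambda>s. set_pmf (W s))"
  by (auto simp: joint_pmf_def)

lemma map_fst_joint_pmf: "map_pmf fst (joint_pmf P W) = P"
  by (simp add: joint_pmf_def map_bind_pmf map_pmf_comp bind_return_pmf')

lemma map_snd_joint_pmf: "map_pmf snd (joint_pmf P W) = bind_pmf P W"
  by (simp add: joint_pmf_def map_bind_pmf map_pmf_comp)

text \<open>A nonnegative distortion with expectation at most 0 vanishes almost surely, so
  feasibility becomes a condition on the support of each row \<open>W s\<close>.\<close>

lemma zero_feasible_channels_iff:
  fixes P :: "'s::finite pmf"
  assumes "\<And>s t. 0 \<le> d s t"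
  shows "W \<in> feasible_channels V d P 0
    \<longleftrightarrow> (\<forall>s\<in>set_pmf P. \<forall>t\<in>set_pmf (W s). t \<in> V \<and> d s t = 0)"
proof -
  let ?J = "joint_pmf P W" and ?f = "\<lambda>(s, t). d s t"
  have nonneg: "0 \<le> ?f x" for x
    using assms by (cases x) simp
  then have "measure_pmf.expectation ?J ?f \<le> 0 \<longleftrightarrow> measure_pmf.expectation ?J ?f = 0"
    using Bochner_Integration.integral_nonneg[of "measure_pmf ?J" ?f] by force
  also have "\<dots> \<longleftrightarrow> (AE x in measure_pmf ?J. ?f x = 0)"
    using nonneg by (intro integral_nonneg_eq_0_iff_AE) (auto intro: integrable_measure_pmf_finite)
  finally show ?thesis
    by (auto simp: feasible_channels_def AE_measure_pmf_iff set_joint_pmf)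
qed

section \<open>Entropy and mutual information as finite sums\<close>

lemma simple_distributed_measure_pmf:
  assumes "finite (range X)"
  shows "simple_distributed (measure_pmf p) X (pmf (map_pmf X p))"
proof (rule measure_pmf.simple_distributedI)
  show "simple_function (measure_pmf p) X"
    using assms by (simp add: simple_function_def)
  show "pmf (map_pmf X p) x = measure_pmf.prob p (X -` {x} \<inter> space (measure_pmf p))" for x
    by (simp add: pmf_map)
qed simp

lemma pmf_entropy_eq_sum:
  fixes p :: "'s::finite pmf"
  assumes "b > 1"
  shows "pmf_entropy b p = - (\<Sum>x\<in>UNIV. pmf p x * log b (pmf p x))"
proof -
  interpret information_space "measure_pmf p" b
    using assms by unfold_locales
  show ?thesis
    using entropy_simple_distributed[OF simple_distributed_measure_pmf[of "\<lambda>x. x" p]]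
    by (simp add: pmf_entropy_def)
qed

lemma channel_information_eq_sum:
  fixes P :: "'s::finite pmf"
  assumes "b > 1"
  shows "channel_information b P W =
    (\<Sum>s\<in>UNIV. \<Sum>t\<in>UNIV. pmf P s * pmf (W s) t * log b (pmf (W s) t / pmf (bind_pmf P W) t))"
proof -
  let ?J = "joint_pmf P W"
  interpret information_space "measure_pmf ?J" b
    using assms by unfold_locales
  have "channel_information b P W = (\<Sum>(s, t)\<in>UNIV.
      pmf ?J (s, t) * log b (pmf ?J (s, t) / (pmf P s * pmf (bind_pmf P W) t)))"
    using mutual_information_simple_distributed[OF
        simple_distributed_measure_pmf[of fst ?J]
        simple_distributed_measure_pmf[of snd ?J]
        simple_distributed_measure_pmf[of "\<lambda>x. (fst x, snd x)" ?J]]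
    by (simp add: channel_information_def map_fst_joint_pmf map_snd_joint_pmf)
  also have "\<dots> = (\<Sum>(s, t)\<in>UNIV.
      pmf P s * pmf (W s) t * log b (pmf (W s) t / pmf (bind_pmf P W) t))"
    by (intro sum.cong) (auto simp: pmf_joint_pmf)
  finally show ?thesis
    by (simp add: sum.cartesian_product flip: UNIV_Times_UNIV)
qed


section \<open>Lower bound on the information\<close>

text \<open>Pointwise Gibbs inequality, from \<open>ln z \<le> z - 1\<close> at
  \<open>z = y / x\<close>; the linear left side sums to a difference of masses.\<close>

lemma mult_log_divide_ge:
  fixes x y :: real
  assumes "b > 1" "x \<ge> 0" "y \<ge> 0" "x > 0 \<Longrightarrow> y > 0"
  shows "(x - y) / ln b \<le> x * log b (x / y)"
proof (cases "x > 0")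
  case True
  with assms have "y > 0" by simp
  with True have "ln (y / x) \<le> y / x - 1"
    by (intro ln_le_minus_one) simp
  with True have "x * ln (y / x) \<le> x * (y / x - 1)"
    by (intro mult_left_mono) auto
  then have "x - y \<le> x * ln (x / y)"
    using True \<open>y > 0\<close> by (simp add: ln_div algebra_simps)
  then show ?thesis
    using assms by (simp add: log_def divide_right_mono)
qed (use assms in \<open>auto simp: divide_nonpos_pos\<close>)

text \<open>Brings the target rate into the form of a sum over the core, in which both bounds are
  proved.\<close>

lemma prob_mult_pmf_entropy_cond_pmf:
  fixes P :: "'s::finite pmf"
  assumes "b > 1" and pos: "measure_pmf.prob P A \<noteq> 0"
  shows "measure_pmf.prob P A * pmf_entropy b (cond_pmf P A)
    = (\<Sum>a\<in>A. pmf P a * log b (measure_pmf.prob P A / pmf P a))"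
proof -
  let ?p = "measure_pmf.prob P A"
  have "?p > 0"
    using pos by (simp add: zero_less_measure_iff)
  have ne: "set_pmf P \<inter> A \<noteq> {}"
    using pos by (simp add: measure_pmf_zero_iff)
  have "pmf_entropy b (cond_pmf P A) = - (\<Sum>a\<in>A. pmf P a / ?p * log b (pmf P a / ?p))"
    using assms(1)
    by (simp add: pmf_entropy_eq_sum pmf_cond[OF ne] if_distrib if_distribR sum.If_cases cong: if_cong)
  also have "?p * \<dots> = (\<Sum>a\<in>A. ?p * - (pmf P a / ?p * log b (pmf P a / ?p)))"
    by (simp add: sum_distrib_left sum_negf)
  also have "\<dots> = (\<Sum>a\<in>A. pmf P a * log b (?p / pmf P a))"
  proof (rule sum.cong)
    fix a
    show "?p * - (pmf P a / ?p * log b (pmf P a / ?p)) = pmf P a * log b (?p / pmf P a)"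
      using \<open>?p > 0\<close> pmf_nonneg[of P a]
      by (cases "pmf P a = 0") (auto simp: log_divide_pos algebra_simps)
  qed simp
  finally show ?thesis .
qed

lemma pmf_bind_finite:
  fixes P :: "'s::finite pmf"
  shows "pmf (bind_pmf P W) t = (\<Sum>s\<in>UNIV. pmf P s * pmf (W s) t)"
  by (simp add: pmf_bind integral_measure_pmf_real[of UNIV] mult.commute)

text \<open>
  By Gibbs' inequality, comparing the joint law with \<open>P(s) Q(t)\<close> off \<open>A\<close> and with
  \<open>P(A) Q(t)\<close> on \<open>A\<close>, where \<open>Q\<close> is the output law. The defect is
  \<open>P(A) (1 - (\<Sum>a\<in>A. Q(R a)))\<close>, which disjointness makes nonnegative.
\<close>

lemma channel_information_ge:
  fixes P :: "'s::finite pmf"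
  assumes "b > 1"
    and supp: "\<And>a. a \<in> A \<Longrightarrow> a \<in> set_pmf P \<Longrightarrow> set_pmf (W a) \<subseteq> R a"
    and disj: "disjoint_family_on R A"
  shows "(\<Sum>a\<in>A. pmf P a * log b (measure_pmf.prob P A / pmf P a)) \<le> channel_information b P W"
proof -
  define p where "p = measure_pmf.prob P A"
  define Q where "Q = bind_pmf P W"
  define q where "q a = measure_pmf.prob Q (R a)" for a
  define I where "I s = (\<Sum>t\<in>UNIV. pmf P s * pmf (W s) t * log b (pmf (W s) t / pmf Q t))" for s
  have "ln b > 0"
    using assms(1) by simp
  have Q_pos: "pmf Q t > 0" if "pmf P s > 0" "pmf (W s) t > 0" for s t
    using that by (auto simp: Q_def pmf_positive_iff)
  have p_eq: "p = (\<Sum>a\<in>A. pmf P a)"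
    by (simp add: p_def measure_measure_pmf_finite)
  \<comment> \<open>Only outputs in \<open>R a\<close> are compared, so the comparison mass for row
    \<open>a\<close> is \<open>p * q a\<close> rather than \<open>p\<close>.\<close>
  have A: "(pmf P a - p * q a) / ln b + pmf P a * log b (p / pmf P a) \<le> I a" if "a \<in> A" for a
  proof (cases "pmf P a = 0")
    case True
    then show ?thesis
      using \<open>ln b > 0\<close> by (simp add: I_def p_def q_def)
  next
    case False
    then have Pa: "pmf P a > 0"
      by (simp add: order_less_le)
    then have "p > 0"
      using that member_le_sum[of a A "pmf P"] by (auto simp: p_eq)
    have R: "set_pmf (W a) \<subseteq> R a"
      using supp[OF that] False by (simp add: set_pmf_iff)
    have W_R: "(\<Sum>t\<in>R a. pmf (W a) t) = 1"
      using R by (intro sum_pmf_eq_1) auto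
    have gibbs: "(pmf P a * pmf (W a) t - p * pmf Q t) / ln b + pmf (W a) t * (pmf P a * log b (p / pmf P a))
        \<le> pmf P a * pmf (W a) t * log b (pmf (W a) t / pmf Q t)" for t
    proof -
      have "(pmf P a * pmf (W a) t - p * pmf Q t) / ln b
          \<le> pmf P a * pmf (W a) t * log b (pmf P a * pmf (W a) t / (p * pmf Q t))"
        using assms(1) \<open>p > 0\<close> Pa Q_pos[of a t]
        by (intro mult_log_divide_ge) (auto simp: zero_less_mult_iff)
      \<comment> \<open>The factor \<open>pmf P a / p\<close> does not depend on \<open>t\<close>,
        so it splits off the logarithm and yields the channel-free term.\<close>
      also have "\<dots> = pmf P a * pmf (W a) t * log b (pmf (W a) t / pmf Q t)
          - pmf (W a) t * (pmf P a * log b (p / pmf P a))"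
      proof (cases "pmf (W a) t = 0")
        case False
        then have "pmf (W a) t > 0"
          by (simp add: order_less_le)
        with Q_pos[OF Pa this] show ?thesis
          using \<open>p > 0\<close> Pa by (simp add: log_divide_pos log_mult_pos algebra_simps)
      qed simp
      finally show ?thesis
        by simp
    qed
    have "(pmf P a - p * q a) / ln b + pmf P a * log b (p / pmf P a)
      = (\<Sum>t\<in>R a. (pmf P a * pmf (W a) t - p * pmf Q t) / ln b
          + pmf (W a) t * (pmf P a * log b (p / pmf P a)))"
      by (simp add: sum.distrib sum_subtractf W_R q_def measure_measure_pmf_finite
          flip: sum_divide_distrib sum_distrib_left sum_distrib_right)
    also have "\<dots> \<le> (\<Sum>t\<in>R a. pmf P a * pmf (W a) t * log b (pmf (W a) t / pmf Q t))"
      by (intro sum_mono gibbs)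
    also have "\<dots> = I a"
      unfolding I_def using R by (intro sum.mono_neutral_left) (auto simp: pmf_eq_0_set_pmf)
    finally show ?thesis .
  qed
  \<comment> \<open>\<open>I s\<close> is \<open>pmf P s\<close> times the relative entropy of
    \<open>W s\<close> with respect to \<open>Q\<close>; this lets the rows outside \<open>A\<close>
    be dropped below.\<close>
  have notA: "0 \<le> I s" for s
  proof (cases "pmf P s = 0")
    case False
    then have Ps: "pmf P s > 0"
      by (simp add: order_less_le)
    have "0 = pmf P s * (\<Sum>t\<in>UNIV. (pmf (W s) t - pmf Q t) / ln b)"
      by (simp add: sum_subtractf sum_pmf_eq_1 flip: sum_divide_distrib)
    also have "\<dots> \<le> pmf P s * (\<Sum>t\<in>UNIV. pmf (W s) t * log b (pmf (W s) t / pmf Q t))"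
      using assms(1) Q_pos[OF Ps] by (intro mult_left_mono sum_mono mult_log_divide_ge) auto
    also have "\<dots> = I s"
      by (simp add: I_def sum_distrib_left mult.assoc)
    finally show ?thesis .
  qed (simp add: I_def)
  \<comment> \<open>Disjointness enters here: the masses \<open>q a\<close> add up to a single
    probability.\<close>
  have "(\<Sum>a\<in>A. q a) = measure_pmf.prob Q (\<Union>a\<in>A. R a)"
    unfolding q_def using disj by (intro measure_pmf.finite_measure_finite_Union[symmetric]) auto
  then have "(\<Sum>a\<in>A. q a) \<le> 1"
    by simp
  then have "p * (\<Sum>a\<in>A. q a) \<le> p"
    by (simp add: p_def mult_left_le)
  then have "0 \<le> (p - p * (\<Sum>a\<in>A. q a)) / ln b"
    using \<open>ln b > 0\<close> by simp
  then have "(\<Sum>a\<in>A. pmf P a * log b (p / pmf P a))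
      \<le> (p - p * (\<Sum>a\<in>A. q a)) / ln b + (\<Sum>a\<in>A. pmf P a * log b (p / pmf P a))"
    by simp
  also have "\<dots> = (\<Sum>a\<in>A. (pmf P a - p * q a) / ln b + pmf P a * log b (p / pmf P a))"
    by (simp add: sum.distrib sum_subtractf p_eq flip: sum_divide_distrib sum_distrib_left)
  also have "\<dots> \<le> (\<Sum>a\<in>A. I a)"
    by (intro sum_mono A)
  also have "\<dots> \<le> (\<Sum>s\<in>UNIV. I s)"
    using notA by (intro sum_mono2) auto
  also have "\<dots> = channel_information b P W"
    using assms(1) by (simp add: channel_information_eq_sum I_def Q_def)
  finally show ?thesis
    by (simp add: p_def)
qed

section \<open>Channels attaining the bound\<close>

lemma channel_information_const:
  fixes P :: "'s::finite pmf"
  assumes "b > 1"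
  shows "channel_information b P (\<lambda>_. q) = 0"
proof -
  have "pmf P s * pmf q t * log b (pmf q t / pmf q t) = 0" for s t
    by (cases "pmf q t = 0") auto
  then show ?thesis
    by (simp only: channel_information_eq_sum[OF assms] bind_pmf_const sum.neutral_const)
qed

text \<open>
  The fallback law \<open>\<mu>\<close> used off \<open>A\<close> is exactly the output law, so the symbols outside \<open>A\<close>
  carry no information.
\<close>

lemma channel_information_core:
  fixes P :: "'s::finite pmf" and A :: "'s set" and f :: "'s \<Rightarrow> 's"
  defines "\<mu> \<equiv> map_pmf f (cond_pmf P A)"
  assumes "b > 1" and pos: "measure_pmf.prob P A \<noteq> 0" and inj: "inj_on f A"
  shows "channel_information b P (\<lambda>s. if s \<in> A then return_pmf (f s) else \<mu>)
    = (\<Sum>a\<in>A. pmf P a * log b (measure_pmf.prob P A / pmf P a))"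
proof -
  let ?p = "measure_pmf.prob P A" and ?W = "\<lambda>s. if s \<in> A then return_pmf (f s) else \<mu>"
  have ne: "set_pmf P \<inter> A \<noteq> {}"
    using pos by (simp add: measure_pmf_zero_iff)
  \<comment> \<open>The core contributes \<open>?p\<close> times \<open>\<mu>\<close> and its
    complement the remaining \<open>1 - ?p\<close> times \<open>\<mu>\<close>.\<close>
  have law: "bind_pmf P ?W = \<mu>"
  proof (rule pmf_eqI)
    fix t
    have "pmf (\<mu>) t = (\<Sum>a\<in>UNIV. pmf (cond_pmf P A) a * pmf (return_pmf (f a)) t)"
      by (simp add: \<mu>_def map_pmf_def pmf_bind_finite)
    also have "\<dots> = (\<Sum>a\<in>A. pmf (cond_pmf P A) a * pmf (return_pmf (f a)) t)"
      by (intro sum.mono_neutral_right) (auto simp: pmf_cond[OF ne])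
    also have "\<dots> = (\<Sum>a\<in>A. pmf P a * pmf (return_pmf (f a)) t) / ?p"
      unfolding sum_divide_distrib by (intro sum.cong) (auto simp: pmf_cond[OF ne])
    finally have *: "(\<Sum>a\<in>A. pmf P a * pmf (return_pmf (f a)) t) = ?p * pmf (\<mu>) t"
      using pos by simp
    have "pmf (bind_pmf P ?W) t
        = (\<Sum>s\<in>A. pmf P s * pmf (return_pmf (f s)) t) + (\<Sum>s\<in>-A. pmf P s * pmf (\<mu>) t)"
      by (simp add: pmf_bind_finite if_distrib if_distribR sum.If_cases cong: if_cong)
    also have "\<dots> = ?p * pmf (\<mu>) t + measure_pmf.prob P (-A) * pmf (\<mu>) t"
      unfolding * by (simp add: measure_measure_pmf_finite sum_distrib_right)
    also have "\<dots> = pmf (\<mu>) t"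
      using measure_pmf.prob_compl[of A P]
      by (simp add: Compl_eq_Diff_UNIV flip: distrib_right)
    finally show "pmf (bind_pmf P ?W) t = pmf (\<mu>) t" .
  qed
  have "(\<Sum>t\<in>UNIV. pmf P s * pmf (?W s) t * log b (pmf (?W s) t / pmf (\<mu>) t))
      = (if s \<in> A then pmf P s * log b (?p / pmf P s) else 0)" for s
  proof (cases "s \<in> A \<and> s \<in> set_pmf P")
    case True
    \<comment> \<open>By injectivity, \<open>s\<close> is the only core symbol sent to
      \<open>f s\<close>.\<close>
    then have "pmf (\<mu>) (f s) = pmf P s / ?p"
      using inj unfolding \<mu>_def
      by (subst pmf_map_inj) (auto simp: pmf_cond[OF ne] set_cond_pmf[OF ne] inj_on_def)
    then show ?thesis
      using True
      by (subst sum.mono_neutral_right[of _ "{f s}"]) (auto simp: pmf_eq_0_set_pmf)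
  next
    \<comment> \<open>Off \<open>A\<close> the row equals the output law, so every ratio with
      nonzero weight is 1; a core symbol of probability 0 contributes nothing.\<close>
    case False
    have "pmf (\<mu>) t * log b (pmf (\<mu>) t / pmf (\<mu>) t) = 0" for t
      by (cases "pmf (\<mu>) t = 0") auto
    with False show ?thesis
      by (auto simp: set_pmf_iff mult.assoc simp del: mult_eq_0_iff intro!: sum.neutral)
  qed
  then show ?thesis
    using assms(2) by (simp only: channel_information_eq_sum law) (simp add: sum.If_cases)
qed

section \<open>The rate at distortion zero\<close>

lemma rate_distortion_eqI:
  assumes "W \<in> feasible_channels V d P D" "channel_information b P W = r"
    and "\<And>W'. W' \<in> feasible_channels V d P D \<Longrightarrow> r \<le> channel_information b P W'"
  shows "rate_distortion b V d P D = ereal r"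
proof -
  have "(LEAST x. x \<in> channel_information b P ` feasible_channels V d P D) = r"
    using assms by (intro Least_equality) auto
  then show ?thesis
    using assms(1) by (auto simp: rate_distortion_def)
qed

theorem mainTheorem9:
  fixes Cn :: "'s::finite set \<Rightarrow> 's set" and KB :: "'s list" and P :: "'s pmf"
    and V :: "'s set" and b :: real
  defines "A \<equiv> Atom Cn KB"
    and "d \<equiv> closure_distortion Cn (set KB)"
    and "R0 \<equiv> zero_distortion_set Cn (set KB) V"
    and "PA \<equiv> measure_pmf.prob P (Atom Cn KB)"
  assumes "deductive_source Cn KB P"
    and "b > 1"
    and "A \<noteq> {}"
  shows "((\<forall>a\<in>A. R0 a \<noteq> {}) \<and>
          (\<forall>a1\<in>A. \<forall>a2\<in>A. a1 \<noteq> a2 \<longrightarrow> R0 a1 \<inter> R0 a2 = {}) \<longrightarrow>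
            rate_distortion b V d P 0 =
              ereal (if PA = 0 then 0 else PA * pmf_entropy b (cond_pmf P A)))
       \<and> ((\<exists>a\<in>A. pmf P a > 0 \<and> R0 a = {}) \<longrightarrow>
            feasible_channels V d P 0 = {} \<and> rate_distortion b V d P 0 = \<infinity>)"
proof (intro conjI impI; (elim conjE)?)
  interpret deductive_source Cn KB P by fact
  have R0_iff: "t \<in> R0 s \<longleftrightarrow> t \<in> V \<and> d s t = 0" for s t
    by (simp add: R0_def d_def zero_distortion_set_def)
  have feasible_iff: "W \<in> feasible_channels V d P 0 \<longleftrightarrow> (\<forall>s\<in>set_pmf P. set_pmf (W s) \<subseteq> R0 s)" for W
    unfolding subset_eq R0_iff
    by (rule zero_feasible_channels_iff) (simp add: d_def closure_distortion_nonneg)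
  have PA_eq: "PA = measure_pmf.prob P A"
    by (simp add: PA_def A_def)
  {
    assume ne: "\<forall>a\<in>A. R0 a \<noteq> {}"
      and disj: "\<forall>a1\<in>A. \<forall>a2\<in>A. a1 \<noteq> a2 \<longrightarrow> R0 a1 \<inter> R0 a2 = {}"
    from ne obtain f where f: "\<And>a. a \<in> A \<Longrightarrow> f a \<in> R0 a"
      using bchoice[of A "\<lambda>a t. t \<in> R0 a"] by blast
    \<comment> \<open>\<open>f a\<close> has zero distortion for \<open>a\<close>, hence is
      derivable from the knowledge base, hence also represents the redundant
      \<open>s\<close>.\<close>
    have outside: "f a \<in> R0 s" if "a \<in> A" "s \<notin> A" for a s
      using f[OF that(1)] that(2) zero_distortion_imp_derivable zero_distortion_outside_Atom
      unfolding R0_iff d_def A_def by blast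
    \<comment> \<open>A common value would lie in two disjoint zero-distortion sets.\<close>
    have "inj_on f A"
      using f disj by (fastforce simp: inj_on_def)
    define T where "T = (\<Sum>a\<in>A. pmf P a * log b (PA / pmf P a))"
    have lower: "T \<le> channel_information b P W" if "W \<in> feasible_channels V d P 0" for W
      unfolding T_def PA_eq using that disj \<open>b > 1\<close>
      by (intro channel_information_ge) (auto simp: feasible_iff disjoint_family_on_def)
    show "rate_distortion b V d P 0 =
        ereal (if PA = 0 then 0 else PA * pmf_entropy b (cond_pmf P A))"
    proof (cases "PA = 0")
      case True
      then have "set_pmf P \<inter> A = {}"
        by (simp add: PA_eq measure_pmf_zero_iff)
      moreover obtain a where "a \<in> A"
        using \<open>A \<noteq> {}\<close> by blast
      \<comment> \<open>All source mass is redundant here, so one core representative serves every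
        symbol and conveys no information.\<close>
      ultimately have "(\<lambda>_. return_pmf (f a)) \<in> feasible_channels V d P 0"
        using outside by (auto simp: feasible_iff)
      moreover have "T = 0"
        using \<open>set_pmf P \<inter> A = {}\<close> unfolding T_def
        by (intro sum.neutral) (auto simp: pmf_eq_0_set_pmf)
      ultimately show ?thesis
        using True lower \<open>b > 1\<close>
        by (simp, intro rate_distortion_eqI) (auto simp: channel_information_const)
    next
      case False
      then have "set_pmf (cond_pmf P A) \<subseteq> A"
        \<comment> \<open>\<open>PA \<noteq> 0\<close> makes the conditioning meaningful: the
          support of \<open>P\<close> meets \<open>A\<close>.\<close>
        by (subst set_cond_pmf) (auto simp: PA_eq measure_pmf_zero_iff)
      then have "(\<lambda>s. if s \<in> A then return_pmf (f s) else map_pmf f (cond_pmf P A))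
          \<in> feasible_channels V d P 0"
        using f outside by (auto simp: feasible_iff)
      moreover have "PA * pmf_entropy b (cond_pmf P A) = T"
        using False \<open>b > 1\<close> by (simp add: T_def PA_eq prob_mult_pmf_entropy_cond_pmf)
      ultimately show ?thesis
        using False lower \<open>b > 1\<close> \<open>inj_on f A\<close>
        by (simp, intro rate_distortion_eqI)
          (auto simp: T_def PA_eq channel_information_core)
    qed
  }
  {
    assume "\<exists>a\<in>A. pmf P a > 0 \<and> R0 a = {}"
    \<comment> \<open>The row of such an \<open>a\<close> has nonempty support, which cannot lie in
      the empty \<open>R0 a\<close>.\<close>
    then have "W \<notin> feasible_channels V d P 0" for W
      unfolding feasible_iff by (metis pmf_positive_iff set_pmf_not_empty subset_empty)
    then show "feasible_channels V d P 0 = {}"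
      by blast
    then show "rate_distortion b V d P 0 = \<infinity>"
      by (simp add: rate_distortion_def)
  }
qed

end
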